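(* Consider the parametric problem $\min_x f(x,\theta)$ subject to $g(x,\theta)\le 0$, with $f:\mathbb{R}^{n_x}\times\mathbb{R}^{n_\theta}\to\mathbb{R}$ quadratic, $g:\mathbb{R}^{n_x}\times\mathbb{R}^{n_\theta}\to\mathbb{R}^m$ affine, and $\theta\in\Theta_0\subseteq\mathbb{R}^{n_\theta}$. Let $\mathcal{P}$ be a program that realizes the dual active-set method described in the context and such that, given a particular processor state at the start of an iteration, the working set $\mathcal{W}$ completely determines the sequence of executed processor instructions and the memory access pattern in that iteration. Let $q_0$ be a processor state, let $\tilde\tau_{\mathcal{P}}$ be the estimate produced by the WCET procedure described in the context with input $\mathcal{P}$, $\Theta_0$, $q_0$ (with or without its optional pruning step), and let $$\bar\tau_{\mathcal{P}}=\max_{\theta\in\Theta_0,\;q\in\mathcal{Q}}\tau_{\mathcal{P}}(\theta,q)$$ be the true worst-case execution time, where $\mathcal{Q}$ is the set of all possible starting processor states of the program online. (i) If $q_0$ is deterministically assigned online, i.e. $\mathcal{P}$ always starts in $q_0$ (so $\mathcal{Q}=\{q_0\}$), then $\tilde\tau_{\mathcal{P}}=\bar\tau_{\mathcal{P}}$. (ii) If, instead, $q_0$ dominates every possible online starting processor state, i.e. $\tau_{\mathcal{P}}(\theta,q_0)\ge\tau_{\mathcal{P}}(\theta,q)$ for all $\theta\in\Theta_0$ and all $q\in\mathcal{Q}$, then $\tilde\tau_{\mathcal{P}}\ge\bar\tau_{\mathcal{P}}$.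
   Context: Programs and execution time. A program is a realization (code, compiler, hardware) of an algorithm that solves the given parametric problem for a given $\theta$. $\tau_{\mathcal{P}}(\theta,q)\in\mathbb{R}$ is the execution time of $\mathcal{P}$, started in processor state $q$, for solving the problem instance $\theta\in\Theta_0$. The program is never interrupted while running. Modeling conventions: a run is a succession of iterations of the underlying algorithm, with $q$ the processor state at the start of the first iteration. "Processor state" means the timing-relevant state (caches, pipeline, etc.), not the numerical values stored in memory or registers. The processor state at the start of the next iteration is determined by the processor state at the start of the current iteration together with the instructions executed and memory accesses made in it. The execution time is the total elapsed time of the run (a sum of nonnegative times spent in its iterations), and is determined by the starting processor state and the complete sequence of executed instructions and memory accesses. Dual active-set method. Given $\theta$, an initial dual iterate $\lambda_0$ and an initial working set $\mathcal{W}_0$ (a set of constraint indices enforced with equality), the method repeats iterations $k=0,1,\dots$ until termination. If $\mathcal{W}_k$ is not singular (its reduced Hessian is nonsingular), compute $\lambda^*$ by solving a linear system defined by $\mathcal{W}_k$. If $\lambda^*\ge 0$, compute $\mu$ as an affine transformation of $\lambda^*$ defined by $\mathcal{W}_k$; if $\mu\ge0$, return "optimum found", otherwise add a constraint to the working set and update $\lambda$. If $\lambda^*\not\ge0$, remove a constraint from the working set and update $\lambda$. If $\mathcal{W}_k$ is singular, compute $p$ by solving a linear system defined by $\mathcal{W}_k$; if $p\ge 0$, return "infeasible problem", otherwise remove a constraint from the working set and update $\lambda$. Certification output. A finite collection of tuples $\{(\bar k_i,\mathbb{W}_i,\Theta_i)\}_{i=1}^N$, with nonempty regions $\Theta_i$,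 such that, for each $i$, every $\theta\in\Theta_i$ makes the active-set method generate the same working-set sequence $\mathbb{W}_i=\{\mathcal{W}_k\}_{k=0}^{\bar k_i}$ (with $\bar k_i$ the number of iterations), and the regions form a partition of $\Theta_0$ in the sense that $\bigcup_{i=1}^N\Theta_i=\Theta_0$ and $\mathring\Theta_i\cap\mathring\Theta_j=\emptyset$ for $i\ne j$ ($\mathring\Theta$ denotes the interior of $\Theta$). Subsequence relation. For working-set sequences, $\tilde{\mathbb{W}}\prec\mathbb{W}$ (equivalently $\mathbb{W}\succ\tilde{\mathbb{W}}$) means that $|\mathbb{W}|>|\tilde{\mathbb{W}}|$ and the first $|\tilde{\mathbb{W}}|$ entries of $\mathbb{W}$ coincide, in order, with those of $\tilde{\mathbb{W}}$, where $|\cdot|$ is the length of a sequence. WCET procedure. (1) Obtain the certification output $\{(\bar k_i,\mathbb{W}_i,\Theta_i)\}_{i=1}^N$ for the active-set method on $\Theta_0$. (2) Set $\mathcal{I}=\{1,\dots,N\}$ and $\tilde\tau=-\infty$. (3) Optional pruning: remove from $\mathcal{I}$ all $i$ for which there exists $j\ne i$ with $\mathbb{W}_j\succ\mathbb{W}_i$. (4) For each $i\in\mathcal{I}$: select any $\theta_i\in\Theta_i$, set the processor state to $q_0$, measure the execution time $\tau_i=\tau_{\mathcal{P}}(\theta_i,q_0)$ of $\mathcal{P}$ with $\theta=\theta_i$, and set $\tilde\tau\leftarrow\max\{\tilde\tau,\tau_i\}$. (5) Return $\tilde\tau_{\mathcal{P}}=\tilde\tau$. *)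

theory Defs
  imports "HOL-Analysis.Analysis" "HOL-Library.Sublist"
begin

section \<open>The parametric quadratic program\<close>

record ('n, 'm, 't) mpqp =
  quad_xx :: "real^'n^'n"
  quad_xt :: "real^'t^'n"
  lin_x :: "real^'n"
  quad_tt :: "real^'t^'t"
  lin_t :: "real^'t"
  const :: real
  con_x :: "real^'n^'m"
  con_t :: "real^'t^'m"
  con_c :: "real^'m"

text \<open>
  \<open>mpqp_coeffs P f g\<close>: \<open>P\<close> holds the coefficients of a function \<open>f\<close> that is quadratic in
  \<open>(x, \<theta>)\<close> and of a function \<open>g\<close> that is affine in \<open>(x, \<theta>)\<close>. Symmetry of the Hessian in \<open>x\<close>
  is no restriction.
\<close>

definition mpqp_coeffs ::
  "('n::finite, 'm::finite, 't::finite) mpqp \<Rightarrow> (real^'n \<Rightarrow> real^'t \<Rightarrow> real)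
    \<Rightarrow> (real^'n \<Rightarrow> real^'t \<Rightarrow> real^'m) \<Rightarrow> bool" where
  "mpqp_coeffs P f g \<longleftrightarrow>
     transpose (quad_xx P) = quad_xx P \<and>
     (\<forall>x \<theta>. f x \<theta> = (1/2) * (x \<bullet> (quad_xx P *v x)) + (quad_xt P *v \<theta> + lin_x P) \<bullet> x
                   + (1/2) * (\<theta> \<bullet> (quad_tt P *v \<theta>)) + lin_t P \<bullet> \<theta> + const P) \<and>
     (\<forall>x \<theta>. g x \<theta> = con_x P *v x + con_t P *v \<theta> + con_c P)"


section \<open>The dual active-set method\<close>

text \<open>
  With \<open>H = quad_xx P\<close>, \<open>h = quad_xt P *v \<theta> + lin_x P\<close> and \<open>A = con_x P\<close>, the Lagrangian
  \<open>f + lam \<bullet> g\<close> is stationary in \<open>x\<close> at \<open>- inverse H (h + transpose A lam)\<close>. Substituting gives the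
  dual problem: minimize \<open>1/2 lam \<bullet> G lam + d \<bullet> lam\<close> over \<open>lam \<ge> 0\<close>, where \<open>G = A (inverse H) (transpose A)\<close>
  and \<open>d\<close> is affine in \<open>\<theta>\<close>. The formulas have this meaning when \<open>H\<close> is invertible (positive
  definite for a genuine dual); this is not needed as a hypothesis.
\<close>

definition dual_hessian :: "('n::finite, 'm::finite, 't::finite) mpqp \<Rightarrow> real^'m^'m" where
  "dual_hessian P = con_x P ** matrix_inv (quad_xx P) ** transpose (con_x P)"

definition dual_lin :: "('n::finite, 'm::finite, 't::finite) mpqp \<Rightarrow> real^'t \<Rightarrow> real^'m" where
  "dual_lin P \<theta> =
     (con_x P ** matrix_inv (quad_xx P)) *v (quad_xt P *v \<theta> + lin_x P)
       - (con_t P *v \<theta> + con_c P)"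

definition primal_of_dual ::
  "('n::finite, 'm::finite, 't::finite) mpqp \<Rightarrow> real^'t \<Rightarrow> real^'m \<Rightarrow> real^'n" where
  "primal_of_dual P \<theta> lam =
     - (matrix_inv (quad_xx P) *v (quad_xt P *v \<theta> + lin_x P + transpose (con_x P) *v lam))"

text \<open>
  The principal submatrix of the dual Hessian on the rows and columns in \<open>W\<close>, padded with the
  identity outside \<open>W\<close> so that its index type does not depend on \<open>W\<close>. It is invertible iff the
  submatrix is, and a solution of a linear system with a right-hand side vanishing outside \<open>W\<close>
  is a solution of the system on \<open>W\<close>, extended by zero.
\<close>

definition reduced_hessian ::
  "('n::finite, 'm::finite, 't::finite) mpqp \<Rightarrow> 'm set \<Rightarrow> real^'m^'m" where
  "reduced_hessian P W =
     (\<chi> i j. if i \<in> W \<and> j \<in> W then dual_hessian P $ i $ j else if i = j then 1 else 0)"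

definition singular_ws ::
  "('n::finite, 'm::finite, 't::finite) mpqp \<Rightarrow> 'm set \<Rightarrow> bool" where
  "singular_ws P W \<longleftrightarrow> \<not> invertible (reduced_hessian P W)"

definition lambda_star ::
  "('n::finite, 'm::finite, 't::finite) mpqp \<Rightarrow> real^'t \<Rightarrow> 'm set \<Rightarrow> real^'m" where
  "lambda_star P \<theta> W =
     (THE lam. reduced_hessian P W *v lam = (\<chi> i. if i \<in> W then - (dual_lin P \<theta> $ i) else 0))"

text \<open>
  \<open>mu P \<theta> lam\<close> is the dual gradient, i.e. the vector of primal slacks \<open>- g x \<theta>\<close> at
  \<open>x = primal_of_dual P \<theta> lam\<close>. At \<open>lam = lambda_star P \<theta> W\<close> its entries in \<open>W\<close> vanish when \<open>W\<close> is not
  singular, so that \<open>0 \<le> mu\<close> only concerns constraints outside \<open>W\<close>.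
\<close>

definition mu ::
  "('n::finite, 'm::finite, 't::finite) mpqp \<Rightarrow> real^'t \<Rightarrow> real^'m \<Rightarrow> real^'m" where
  "mu P \<theta> lam = dual_hessian P *v lam + dual_lin P \<theta>"

lemma matrix_inv_inverse:
  fixes K :: "real^'a::finite^'a"
  assumes "invertible K"
  shows "K ** matrix_inv K = mat 1 \<and> matrix_inv K ** K = mat 1"
  using assms unfolding invertible_def matrix_inv_def by (rule someI_ex)

lemma primal_of_dual_stationary:
  assumes "invertible (quad_xx P)"
  shows "quad_xx P *v primal_of_dual P \<theta> lam + (quad_xt P *v \<theta> + lin_x P)
           + transpose (con_x P) *v lam = 0"
proof -
  have "quad_xx P *v (matrix_inv (quad_xx P) *v v) = v" for v
    using matrix_inv_inverse[OF assms] by (simp add: matrix_vector_mul_assoc)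
  then show ?thesis
    by (simp add: primal_of_dual_def vec.neg del: transpose_matrix_vector)
qed

lemma mu_eq_slack:
  assumes "mpqp_coeffs P f g"
  shows "mu P \<theta> lam = - g (primal_of_dual P \<theta> lam) \<theta>"
  using assms
  by (simp add: mpqp_coeffs_def mu_def dual_hessian_def dual_lin_def primal_of_dual_def vec.neg
      vec.add matrix_vector_mul_assoc matrix_mul_assoc algebra_simps del: transpose_matrix_vector)

lemma mu_lambda_star_zero:
  assumes "\<not> singular_ws P W" and "i \<in> W"
  shows "mu P \<theta> (lambda_star P \<theta> W) $ i = 0"
proof -
  let ?K = "reduced_hessian P W" and ?l = "lambda_star P \<theta> W"
  let ?r = "\<chi> i. if i \<in> W then - (dual_lin P \<theta> $ i) else 0"
  have K: "invertible ?K" using assms(1) by (simp add: singular_ws_def)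
  have "\<exists>!lam. ?K *v lam = ?r"
  proof (rule ex1I[of _ "matrix_inv ?K *v ?r"])
    show "?K *v (matrix_inv ?K *v ?r) = ?r"
      using matrix_inv_inverse[OF K] by (simp add: matrix_vector_mul_assoc)
    show "lam = matrix_inv ?K *v ?r" if "?K *v lam = ?r" for lam
      using matrix_inv_inverse[OF K] that[symmetric] by (simp add: matrix_vector_mul_assoc)
  qed
  then have l: "?K *v ?l = ?r" unfolding lambda_star_def by (rule theI')
  have out: "?l $ j = 0" if "j \<notin> W" for j
  proof -
    have "(?K *v ?l) $ j = ?l $ j"
      using that
      by (simp add: matrix_vector_mult_def reduced_hessian_def if_distrib[of "\<lambda>c. c * _"] cong: if_cong)
    then show ?thesis using l that by simp
  qed
  have "(?K *v ?l) $ i = (dual_hessian P *v ?l) $ i"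
    using assms(2) out
    by (auto simp: matrix_vector_mult_def reduced_hessian_def intro!: sum.cong)
  then show ?thesis using l assms(2) by (simp add: mu_def)
qed

text \<open>
  The method leaves open how the constraint to be added or removed is selected, how \<open>lam\<close> is updated,
  and which solution of the singular system is taken. These are arbitrary functions of \<open>\<theta>\<close>, the
  current dual iterate and the current working set; \<open>add_rule\<close> and \<open>remove_rule\<close> return the selected
  constraint and the updated dual iterate.
\<close>

record ('m, 't) das_method =
  null_dir :: "real^'t \<Rightarrow> real^'m \<Rightarrow> 'm set \<Rightarrow> real^'m"
  add_rule :: "real^'t \<Rightarrow> real^'m \<Rightarrow> 'm set \<Rightarrow> 'm \<times> (real^'m)"
  remove_rule :: "real^'t \<Rightarrow> real^'m \<Rightarrow> 'm set \<Rightarrow> 'm \<times> (real^'m)"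
  init_dual :: "real^'m"
  init_ws :: "'m set"

datatype 'm das_outcome = Optimum | Infeasible | Continue "real^'m" "'m set"

definition das_step ::
  "('n::finite, 'm::finite, 't::finite) mpqp \<Rightarrow> ('m, 't) das_method
    \<Rightarrow> real^'t \<Rightarrow> real^'m \<Rightarrow> 'm set \<Rightarrow> 'm das_outcome" where
  "das_step P M \<theta> lam W =
     (let add = (case add_rule M \<theta> lam W of (j, lam') \<Rightarrow> Continue lam' (insert j W));
          remove = (case remove_rule M \<theta> lam W of (j, lam') \<Rightarrow> Continue lam' (W - {j}))
      in if \<not> singular_ws P W then
           (if 0 \<le> lambda_star P \<theta> W then
              (if 0 \<le> mu P \<theta> (lambda_star P \<theta> W) then Optimum else add)
            else remove)
         else
           (if 0 \<le> null_dir M \<theta> lam W then Infeasible else remove))"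

text \<open>
  In the singular case the direction is a nonzero solution of the homogeneous system on \<open>W\<close>, signed
  so that the dual objective does not increase along it; such a direction always exists.
\<close>

definition valid_das_method ::
  "('n::finite, 'm::finite, 't::finite) mpqp \<Rightarrow> ('m, 't) das_method \<Rightarrow> bool" where
  "valid_das_method P M \<longleftrightarrow>
     (\<forall>\<theta> lam W. singular_ws P W \<longrightarrow>
        null_dir M \<theta> lam W \<noteq> 0 \<and> reduced_hessian P W *v null_dir M \<theta> lam W = 0 \<and>
        dual_lin P \<theta> \<bullet> null_dir M \<theta> lam W \<le> 0) \<and>
     (\<forall>\<theta> lam W. \<not> singular_ws P W \<and> 0 \<le> lambda_star P \<theta> W \<and>
        \<not> 0 \<le> mu P \<theta> (lambda_star P \<theta> W) \<longrightarrow> fst (add_rule M \<theta> lam W) \<notin> W) \<and>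
     (\<forall>\<theta> lam W. \<not> singular_ws P W \<and> \<not> 0 \<le> lambda_star P \<theta> W \<or>
        singular_ws P W \<and> \<not> 0 \<le> null_dir M \<theta> lam W \<longrightarrow> fst (remove_rule M \<theta> lam W) \<in> W)"

text \<open>\<open>None\<close> means that the method has returned before iteration \<open>k\<close>.\<close>

primrec das_iterate ::
  "('n::finite, 'm::finite, 't::finite) mpqp \<Rightarrow> ('m, 't) das_method
    \<Rightarrow> real^'t \<Rightarrow> nat \<Rightarrow> ((real^'m) \<times> 'm set) option" where
  "das_iterate P M \<theta> 0 = Some (init_dual M, init_ws M)"
| "das_iterate P M \<theta> (Suc k) =
     (case das_iterate P M \<theta> k of
        None \<Rightarrow> None
      | Some (lam, W) \<Rightarrow>
          (case das_step P M \<theta> lam W of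
             Continue lam' W' \<Rightarrow> Some (lam', W')
           | Optimum \<Rightarrow> None
           | Infeasible \<Rightarrow> None))"

text \<open>
  \<open>generates P M \<theta> Ws\<close>: the method terminates on \<open>\<theta>\<close> and \<open>Ws\<close> lists the working sets of all its
  iterations, including the one in which it returns.
\<close>

definition generates ::
  "('n::finite, 'm::finite, 't::finite) mpqp \<Rightarrow> ('m, 't) das_method
    \<Rightarrow> real^'t \<Rightarrow> 'm set list \<Rightarrow> bool" where
  "generates P M \<theta> Ws \<longleftrightarrow>
     (\<forall>k < length Ws. \<exists>lam. das_iterate P M \<theta> k = Some (lam, Ws ! k)) \<and>
     das_iterate P M \<theta> (length Ws) = None"


section \<open>Programs and execution time\<close>

text \<open>The executed instructions and the memory accesses, in order, of one iteration.\<close>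

type_synonym ('ins, 'mem) trace = "'ins list \<times> 'mem list"

text \<open>
  \<open>run p \<theta> q\<close> lists, for the run on instance \<open>\<theta>\<close> started in processor state \<open>q\<close>, the working set and
  the trace of every iteration. \<open>next_state\<close> and \<open>elapsed\<close> describe the hardware: the processor state
  after, and the time spent in, an iteration with a given processor state at its start and a given
  trace.
\<close>

record ('m, 't, 'q, 'ins, 'mem) program =
  run :: "real^'t \<Rightarrow> 'q \<Rightarrow> ('m set \<times> ('ins, 'mem) trace) list"
  next_state :: "'q \<Rightarrow> ('ins, 'mem) trace \<Rightarrow> 'q"
  elapsed :: "'q \<Rightarrow> ('ins, 'mem) trace \<Rightarrow> real"

primrec trace_time ::
  "('q \<Rightarrow> 'e \<Rightarrow> 'q) \<Rightarrow> ('q \<Rightarrow> 'e \<Rightarrow> real) \<Rightarrow> 'q \<Rightarrow> 'e list \<Rightarrow> real" where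
  "trace_time nxt el q [] = 0"
| "trace_time nxt el q (e # es) = el q e + trace_time nxt el (nxt q e) es"

definition exec_time ::
  "('m, 't::finite, 'q, 'ins, 'mem) program \<Rightarrow> real^'t \<Rightarrow> 'q \<Rightarrow> real" where
  "exec_time p \<theta> q = trace_time (next_state p) (elapsed p) q (map snd (run p \<theta> q))"

definition state_at ::
  "('m, 't::finite, 'q, 'ins, 'mem) program \<Rightarrow> real^'t \<Rightarrow> 'q \<Rightarrow> nat \<Rightarrow> 'q" where
  "state_at p \<theta> q k = foldl (next_state p) q (map snd (take k (run p \<theta> q)))"

definition realizes ::
  "('m::finite, 't::finite, 'q, 'ins, 'mem) program \<Rightarrow> ('n::finite, 'm, 't) mpqp
    \<Rightarrow> ('m, 't) das_method \<Rightarrow> (real^'t) set \<Rightarrow> bool" where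
  "realizes p P M \<Theta>\<^sub>0 \<longleftrightarrow>
     (\<forall>\<theta>\<in>\<Theta>\<^sub>0. \<forall>q Ws. generates P M \<theta> Ws \<longrightarrow> map fst (run p \<theta> q) = Ws)"

definition ws_determines_trace ::
  "('m, 't::finite, 'q, 'ins, 'mem) program \<Rightarrow> (real^'t) set \<Rightarrow> bool" where
  "ws_determines_trace p \<Theta>\<^sub>0 \<longleftrightarrow>
     (\<forall>\<theta>\<in>\<Theta>\<^sub>0. \<forall>\<theta>'\<in>\<Theta>\<^sub>0. \<forall>q q' k k'.
        k < length (run p \<theta> q) \<longrightarrow> k' < length (run p \<theta>' q') \<longrightarrow>
        state_at p \<theta> q k = state_at p \<theta>' q' k' \<longrightarrow>
        fst (run p \<theta> q ! k) = fst (run p \<theta>' q' ! k') \<longrightarrow>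
        snd (run p \<theta> q ! k) = snd (run p \<theta>' q' ! k'))"

text \<open>
  The true worst case. It is valued in \<open>ereal\<close> and formed as a supremum, which is the maximum
  whenever the maximum exists and is meaningful also if it does not.
\<close>

definition true_wcet ::
  "(real^'t::finite \<Rightarrow> 'q \<Rightarrow> real) \<Rightarrow> (real^'t) set \<Rightarrow> 'q set \<Rightarrow> ereal" where
  "true_wcet \<tau> \<Theta>\<^sub>0 Q = (SUP (\<theta>, q) \<in> \<Theta>\<^sub>0 \<times> Q. ereal (\<tau> \<theta> q))"

definition wcet_attained ::
  "(real^'t::finite \<Rightarrow> 'q \<Rightarrow> real) \<Rightarrow> (real^'t) set \<Rightarrow> 'q set \<Rightarrow> bool" where
  "wcet_attained \<tau> \<Theta>\<^sub>0 Q \<longleftrightarrow> (\<exists>\<theta>\<in>\<Theta>\<^sub>0. \<exists>q\<in>Q. true_wcet \<tau> \<Theta>\<^sub>0 Q = ereal (\<tau> \<theta> q))"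


section \<open>Certification and the WCET procedure\<close>

text \<open>The sequence \<open>WW i\<close> is indexed from \<open>0\<close> to \<open>kbar i\<close>, hence has \<open>kbar i + 1\<close> entries.\<close>

definition certification ::
  "('n::finite, 'm::finite, 't::finite) mpqp \<Rightarrow> ('m, 't) das_method \<Rightarrow> (real^'t) set
    \<Rightarrow> nat \<Rightarrow> (nat \<Rightarrow> nat) \<Rightarrow> (nat \<Rightarrow> 'm set list) \<Rightarrow> (nat \<Rightarrow> (real^'t) set) \<Rightarrow> bool" where
  "certification P M \<Theta>\<^sub>0 N kbar WW \<Theta> \<longleftrightarrow>
     (\<forall>i\<in>{1..N}. \<Theta> i \<noteq> {} \<and> length (WW i) = kbar i + 1 \<and> (\<forall>\<theta>\<in>\<Theta> i. generates P M \<theta> (WW i))) \<and>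
     (\<Union>i\<in>{1..N}. \<Theta> i) = \<Theta>\<^sub>0 \<and>
     (\<forall>i\<in>{1..N}. \<forall>j\<in>{1..N}. i \<noteq> j \<longrightarrow> interior (\<Theta> i) \<inter> interior (\<Theta> j) = {})"

definition ws_prec :: "'a list \<Rightarrow> 'a list \<Rightarrow> bool" (infix "\<prec>ws" 50) where
  "V \<prec>ws W \<longleftrightarrow> length V < length W \<and> prefix V W"

definition index_set :: "bool \<Rightarrow> nat \<Rightarrow> (nat \<Rightarrow> 'a list) \<Rightarrow> nat set" where
  "index_set prune N WW =
     (if prune then {1..N} - {i\<in>{1..N}. \<exists>j\<in>{1..N}. j \<noteq> i \<and> WW i \<prec>ws WW j} else {1..N})"

text \<open>
  \<open>wcet_estimate \<tau> q\<^sub>0 N WW \<Theta> prune t\<close>: \<open>t\<close> is a possible result of the procedure, which is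
  nondeterministic in the selection of the parameters that are measured.
\<close>

definition wcet_estimate ::
  "(real^'t::finite \<Rightarrow> 'q \<Rightarrow> real) \<Rightarrow> 'q \<Rightarrow> nat \<Rightarrow> (nat \<Rightarrow> 'a list)
    \<Rightarrow> (nat \<Rightarrow> (real^'t) set) \<Rightarrow> bool \<Rightarrow> ereal \<Rightarrow> bool" where
  "wcet_estimate \<tau> q\<^sub>0 N WW \<Theta> prune t \<longleftrightarrow>
     (\<exists>sel. (\<forall>i\<in>index_set prune N WW. sel i \<in> \<Theta> i) \<and>
            t = Max (insert (-\<infinity>) ((\<lambda>i. ereal (\<tau> (sel i) q\<^sub>0)) ` index_set prune N WW)))"

end

theory Submission
  imports Defs
begin

text \<open>
  By induction over the iterations, the start state and the working-set sequence determine the trace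
  of a run; if the working-set sequence of one run is a prefix of that of another, then so is its
  trace, and its execution time is at most that of the other because iteration times are nonnegative.
  Hence one measurement per region suffices, and pruned regions are dominated by a remaining region
  whose sequence is longest among the extensions.
\<close>

lemma trace_time_append:
  "trace_time nxt el q (xs @ ys) = trace_time nxt el q xs + trace_time nxt el (foldl nxt q xs) ys"
  by (induction xs arbitrary: q) auto

lemma trace_time_nonneg:
  assumes "\<And>q e. 0 \<le> el q e"
  shows "0 \<le> trace_time nxt el q es"
  by (induction es arbitrary: q) (auto intro: add_nonneg_nonneg assms)

text \<open>The rest of \<open>ys\<close> is timed from the state that \<open>xs\<close> leaves
  behind, so nonnegativity is required in every state, not only in \<open>q\<close>.\<close>

lemma trace_time_prefix_mono:
  assumes "\<And>q e. 0 \<le> el q e" and "prefix xs ys"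
  shows "trace_time nxt el q xs \<le> trace_time nxt el q ys"
  using assms(2) trace_time_nonneg[of el, OF assms(1)]
  by (auto simp: prefix_def trace_time_append)

lemma trace_prefix_if_ws_prefix:
  assumes det: "ws_determines_trace p \<Theta>\<^sub>0"
    and \<theta>: "\<theta> \<in> \<Theta>\<^sub>0" "\<theta>' \<in> \<Theta>\<^sub>0"
    and ws: "prefix (map fst (run p \<theta> q)) (map fst (run p \<theta>' q))"
  shows "prefix (map snd (run p \<theta> q)) (map snd (run p \<theta>' q))"
proof -
  let ?r = "run p \<theta> q" and ?r' = "run p \<theta>' q"
  have len: "length ?r \<le> length ?r'"
    using prefix_length_le[OF ws] by simp
  have fst_eq: "fst (?r ! k) = fst (?r' ! k)" if "k < length ?r" for k
  proof -
    have "map fst ?r ! k = map fst ?r' ! k"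
      using ws that by (auto simp: prefix_def nth_append)
    then show ?thesis
      using that len by simp
  qed
  \<comment> \<open>The claim covers all of the first \<open>k\<close> traces at once, since the
    state before iteration \<open>k\<close> depends on every earlier trace.\<close>
  have "take k (map snd ?r) = take k (map snd ?r')" if "k \<le> length ?r" for k
    using that
  proof (induction k)
    case (Suc k)
    then have k: "k < length ?r" "k < length ?r'"
      using len by auto
    have IH: "take k (map snd ?r) = take k (map snd ?r')"
      using Suc by simp
    \<comment> \<open>\<open>state_at\<close> folds \<open>next_state\<close> over the first
      \<open>k\<close> traces from the common start \<open>q\<close>, so equal traces so far lead to
      equal states.\<close>
    then have "state_at p \<theta> q k = state_at p \<theta>' q k"
      by (simp add: state_at_def take_map)
    then have "snd (?r ! k) = snd (?r' ! k)"
      using det \<theta> k fst_eq[OF k(1)] unfolding ws_determines_trace_def by blast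
    then show ?case
      using IH k by (simp add: take_Suc_conv_app_nth)
  qed simp
  from this[of "length ?r"] show ?thesis
    by (metis length_map order_refl take_all take_is_prefix)
qed

lemma exec_time_prefix_mono:
  assumes "ws_determines_trace p \<Theta>\<^sub>0" and "\<theta> \<in> \<Theta>\<^sub>0" "\<theta>' \<in> \<Theta>\<^sub>0"
    and "\<And>q e. 0 \<le> elapsed p q e"
    and "prefix (map fst (run p \<theta> q)) (map fst (run p \<theta>' q))"
  shows "exec_time p \<theta> q \<le> exec_time p \<theta>' q"
  unfolding exec_time_def
  using assms by (intro trace_time_prefix_mono trace_prefix_if_ws_prefix)

lemma finite_index_set: "finite (index_set prune N WW)"
  by (simp add: index_set_def)

lemma index_set_subset: "index_set prune N WW \<subseteq> {1..N}"
  by (auto simp: index_set_def)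

text \<open>The relation \<open>\<prec>ws\<close> is strict in length, so regions with equal
  sequences never prune each other and a longest extension of \<open>WW i\<close> survives. Choosing
  it serves both values of \<open>prune\<close>.\<close>

lemma index_set_covers:
  assumes "i \<in> {1..N}"
  obtains j where "j \<in> index_set prune N WW" and "prefix (WW i) (WW j)"
proof -
  define E where "E = {j \<in> {1..N}. prefix (WW i) (WW j)}"
  have "finite E" and "E \<noteq> {}"
    using assms by (auto simp: E_def)
  then obtain j where j: "j \<in> E" and Max: "Max ((\<lambda>l. length (WW l)) ` E) = length (WW j)"
    using obtains_MAX[of E "\<lambda>l. length (WW l)"] by metis
  have max: "length (WW l) \<le> length (WW j)" if "l \<in> E" for l
    unfolding Max[symmetric] using \<open>finite E\<close> that by simp
  \<comment> \<open>By transitivity of \<open>prefix\<close>, a strict extension of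
    \<open>WW j\<close> would again extend \<open>WW i\<close>, hence lie in \<open>E\<close> and be
    longer than the longest member.\<close>
  have "\<not> WW j \<prec>ws WW l" if "l \<in> {1..N}" for l
  proof
    assume "WW j \<prec>ws WW l"
    then have "l \<in> E" and "length (WW j) < length (WW l)"
      using j that by (auto simp: E_def ws_prec_def intro: prefix_order.trans)
    then show False
      using max[of l] by simp
  qed
  then have "j \<in> index_set prune N WW"
    using j by (auto simp: E_def index_set_def)
  then show thesis
    using that j unfolding E_def by blast
qed

lemma run_ws_certification:
  assumes "realizes p P M \<Theta>\<^sub>0" and "certification P M \<Theta>\<^sub>0 N kbar WW \<Theta>"
    and "i \<in> {1..N}" and "\<theta> \<in> \<Theta> i"
  shows "\<theta> \<in> \<Theta>\<^sub>0" and "map fst (run p \<theta> q) = WW i"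
proof -
  show "\<theta> \<in> \<Theta>\<^sub>0"
    using assms(2-4) unfolding certification_def by blast
  moreover have "generates P M \<theta> (WW i)"
    using assms(2-4) unfolding certification_def by blast
  ultimately show "map fst (run p \<theta> q) = WW i"
    using assms(1) unfolding realizes_def by blast
qed

text \<open>Together the two claims make \<open>t\<close> the maximum over
  \<open>\<Theta>\<^sub>0\<close> from state \<open>q\<^sub>0\<close>, whichever parameters were
  measured. Equality in the theorem uses both; the dominated case follows from the upper
  bound.\<close>

lemma wcet_estimate_is_maximum:
  assumes "\<Theta>\<^sub>0 \<noteq> {}"
    and real: "realizes p P M \<Theta>\<^sub>0"
    and det: "ws_determines_trace p \<Theta>\<^sub>0"
    and nonneg: "\<And>q e. 0 \<le> elapsed p q e"
    and cert: "certification P M \<Theta>\<^sub>0 N kbar WW \<Theta>"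
    and est: "wcet_estimate (exec_time p) q\<^sub>0 N WW \<Theta> prune t"
  shows "\<exists>\<theta>\<in>\<Theta>\<^sub>0. t = ereal (exec_time p \<theta> q\<^sub>0)"
    and "\<theta> \<in> \<Theta>\<^sub>0 \<Longrightarrow> ereal (exec_time p \<theta> q\<^sub>0) \<le> t"
proof -
  let ?I = "index_set prune N WW"
  obtain sel where sel: "\<And>i. i \<in> ?I \<Longrightarrow> sel i \<in> \<Theta> i"
    and t: "t = Max (insert (-\<infinity>) ((\<lambda>i. ereal (exec_time p (sel i) q\<^sub>0)) ` ?I))"
    using est unfolding wcet_estimate_def by blast
  have upper: "ereal (exec_time p (sel j) q\<^sub>0) \<le> t" if "j \<in> ?I" for j
    unfolding t using that by (intro Max_ge) (auto simp: finite_index_set)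
  have sel_run: "sel j \<in> \<Theta>\<^sub>0" "map fst (run p (sel j) q\<^sub>0) = WW j" if "j \<in> ?I" for j
    using run_ws_certification[OF real cert _ sel[OF that]] index_set_subset that by blast+
  have bound: "ereal (exec_time p \<theta> q\<^sub>0) \<le> t" if "\<theta> \<in> \<Theta>\<^sub>0" for \<theta>
  proof -
    obtain i where i: "i \<in> {1..N}" "\<theta> \<in> \<Theta> i"
    proof -
      have "(\<Union>i\<in>{1..N}. \<Theta> i) = \<Theta>\<^sub>0"
        using cert unfolding certification_def by (elim conjE)
      then show thesis
        using \<open>\<theta> \<in> \<Theta>\<^sub>0\<close> that by blast
    qed
    obtain j where j: "j \<in> ?I" "prefix (WW i) (WW j)"
      using index_set_covers[OF i(1)] by blast
    \<comment> \<open>The run on \<open>\<theta>\<close> passes through \<open>WW i\<close> and the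
      measured run through its extension \<open>WW j\<close>, both from
      \<open>q\<^sub>0\<close>.\<close>
    have "exec_time p \<theta> q\<^sub>0 \<le> exec_time p (sel j) q\<^sub>0"
      using exec_time_prefix_mono[OF det that sel_run(1)[OF j(1)] nonneg] j
      by (simp add: run_ws_certification(2)[OF real cert i] sel_run(2))
    then show ?thesis
      using upper[OF j(1)] by (meson ereal_less_eq(3) order_trans)
  qed
  then show "\<theta> \<in> \<Theta>\<^sub>0 \<Longrightarrow> ereal (exec_time p \<theta> q\<^sub>0) \<le> t" .
  \<comment> \<open>A point of \<open>\<Theta>\<^sub>0\<close> puts a real number below
    \<open>t\<close>. This rules out the initial value of the running maximum, so \<open>t\<close>
    is one of the measured times.\<close>
  have "t \<noteq> -\<infinity>"
    using bound \<open>\<Theta>\<^sub>0 \<noteq> {}\<close> by force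
  moreover have "t \<in> insert (-\<infinity>) ((\<lambda>i. ereal (exec_time p (sel i) q\<^sub>0)) ` ?I)"
    unfolding t by (intro Max_in) (auto simp: finite_index_set)
  ultimately show "\<exists>\<theta>\<in>\<Theta>\<^sub>0. t = ereal (exec_time p \<theta> q\<^sub>0)"
    using sel_run(1) by blast
qed

theorem theorem2:
  fixes f :: "real^'n::finite \<Rightarrow> real^'t::finite \<Rightarrow> real"
    and g :: "real^'n \<Rightarrow> real^'t \<Rightarrow> real^'m::finite"
    and P :: "('n, 'm, 't) mpqp"
    and M :: "('m, 't) das_method"
    and p :: "('m, 't, 'q, 'ins, 'mem) program"
    and \<Theta>\<^sub>0 :: "(real^'t) set"
    and N :: nat
    and kbar :: "nat \<Rightarrow> nat"
    and WW :: "nat \<Rightarrow> 'm set list"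
    and \<Theta> :: "nat \<Rightarrow> (real^'t) set"
    and prune :: bool
    and q\<^sub>0 :: 'q
    and Q :: "'q set"
    and \<tau>_est :: ereal
  assumes "mpqp_coeffs P f g"
    and "\<Theta>\<^sub>0 \<noteq> {}"
    and "valid_das_method P M"
    and "realizes p P M \<Theta>\<^sub>0"
    and "ws_determines_trace p \<Theta>\<^sub>0"
    and "\<forall>q e. 0 \<le> elapsed p q e"
    and "certification P M \<Theta>\<^sub>0 N kbar WW \<Theta>"
    and "wcet_estimate (exec_time p) q\<^sub>0 N WW \<Theta> prune \<tau>_est"
  shows "(Q = {q\<^sub>0} \<longrightarrow>
            wcet_attained (exec_time p) \<Theta>\<^sub>0 Q \<and> \<tau>_est = true_wcet (exec_time p) \<Theta>\<^sub>0 Q) \<and>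
         ((\<forall>\<theta>\<in>\<Theta>\<^sub>0. \<forall>q\<in>Q. exec_time p \<theta> q\<^sub>0 \<ge> exec_time p \<theta> q) \<longrightarrow>
            \<tau>_est \<ge> true_wcet (exec_time p) \<Theta>\<^sub>0 Q)"
proof (intro conjI impI)
  have attained: "\<exists>\<theta>\<in>\<Theta>\<^sub>0. \<tau>_est = ereal (exec_time p \<theta> q\<^sub>0)"
    and upper: "\<And>\<theta>. \<theta> \<in> \<Theta>\<^sub>0 \<Longrightarrow> ereal (exec_time p \<theta> q\<^sub>0) \<le> \<tau>_est"
    using wcet_estimate_is_maximum[OF assms(2,4,5) _ assms(7,8)] assms(6) by blast+
  {
    assume Q: "Q = {q\<^sub>0}"
    show eq: "\<tau>_est = true_wcet (exec_time p) \<Theta>\<^sub>0 Q"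
      unfolding true_wcet_def Q
    proof (rule antisym)
      show "\<tau>_est \<le> (SUP (\<theta>, q) \<in> \<Theta>\<^sub>0 \<times> {q\<^sub>0}. ereal (exec_time p \<theta> q))"
        using attained by (auto intro!: SUP_upper2)
    qed (auto intro!: SUP_least upper)
    show "wcet_attained (exec_time p) \<Theta>\<^sub>0 Q"
      using attained eq Q unfolding wcet_attained_def by simp
  }
  assume "\<forall>\<theta>\<in>\<Theta>\<^sub>0. \<forall>q\<in>Q. exec_time p \<theta> q\<^sub>0 \<ge> exec_time p \<theta> q"
  \<comment> \<open>Dominance passes from \<open>q\<close> to \<open>q\<^sub>0\<close> at the same
    parameter, where \<open>upper\<close> applies.\<close>
  then show "\<tau>_est \<ge> true_wcet (exec_time p) \<Theta>\<^sub>0 Q"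
    unfolding true_wcet_def
    using upper by (force intro!: SUP_least intro: order_trans[of _ "ereal (exec_time p _ q\<^sub>0)"])
qed

end
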